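(* Let $\mathcal T(z;u,v)=\mathcal G_4[Dz:(Du\times Dv)]-\int_{[-1,1]^3}Dz:(Du\times Dv)\,d\xi$, where $\mathcal G_4$ is the tensor Gauss--Legendre rule with four points per coordinate on $[-1,1]^3$. Then $$\{z\in\mathcal S_3^3:\ \mathcal T(z;u,v)=0\ \ \forall\,u,v\in\mathcal S_3^3\}=\Bigl(\mathcal S_2\oplus\operatorname{span}\{x^3yz,\;xy^3z,\;xyz^3\}\Bigr)^3 .$$ If the candidate space $\mathcal S_3^3$ is kept fixed and only the variations are enlarged to $\mathbb Q_3^3$, then $$\{z\in\mathcal S_3^3:\ \mathcal T(z;u,v)=0\ \ \forall\,u,v\in\mathbb Q_3^3\}=\mathcal S_2^3 .$$
   Context: The superlinear degree of a monomial $x^{\alpha_1}y^{\alpha_2}z^{\alpha_3}$ is $\sum_{i:\alpha_i\ge2}\alpha_i$. $\mathcal S_p$ (serendipity space) is the span of all monomials in $x,y,z$ of superlinear degree at most $p$. $\mathbb Q_p$ is the space of real polynomials of degree at most $p$ in each coordinate. A superscript $3$ denotes vector fields with all three components in the indicated scalar space. $Dz$ is the Jacobian matrix (rows: components, columns: coordinates). For $A,B\in\mathbb R^{3\times3}$: $A:B=\operatorname{tr}(A^TB)$; $\operatorname{cof}A$ is the matrix of signed $2\times2$ minors; $A\times B=\operatorname{cof}(A+B)-\operatorname{cof}A-\operatorname{cof}B$. *)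

theory Defs
  imports
    "HOL-Analysis.Analysis"
    "HOL-Computational_Algebra.Polynomial"
    "HOL-Library.Function_Algebras"
    "HOL-Library.Set_Algebras"
begin

section \<open>Functions as a real vector space\<close>

text \<open>This makes the library's linear \<open>span\<close> available for sets of functions.\<close>

instantiation "fun" :: (type, real_vector) real_vector
begin

definition scaleR_fun_def: "scaleR c f = (\<lambda>x. scaleR c (f x))"

instance
  by standard
    (auto simp: scaleR_fun_def plus_fun_def scaleR_add_right scaleR_add_left)

end

section \<open>Polynomial spaces\<close>

text \<open>
  Real polynomials in three variables are represented by the polynomial functions on all of
  \<open>\<real>\<^sup>3\<close>; the coordinates \<open>x, y, z\<close> of a point \<open>\<xi>\<close> are \<open>\<xi>$1, \<xi>$2, \<xi>$3\<close>.
\<close>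

definition monomial_fn :: "nat ^ 3 \<Rightarrow> real ^ 3 \<Rightarrow> real" where
  "monomial_fn \<alpha> = (\<lambda>\<xi>. \<Prod>i\<in>UNIV. (\<xi> $ i) ^ (\<alpha> $ i))"

definition superlinear_degree :: "nat ^ 3 \<Rightarrow> nat" where
  "superlinear_degree \<alpha> = (\<Sum>i | \<alpha> $ i \<ge> 2. \<alpha> $ i)"

definition serendipity :: "nat \<Rightarrow> (real ^ 3 \<Rightarrow> real) set" where
  "serendipity p = span {monomial_fn \<alpha> | \<alpha>. superlinear_degree \<alpha> \<le> p}"

definition tensor_poly :: "nat \<Rightarrow> (real ^ 3 \<Rightarrow> real) set" where
  "tensor_poly p = span {monomial_fn \<alpha> | \<alpha>. \<forall>i. \<alpha> $ i \<le> p}"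

definition vector_fields :: "(real ^ 3 \<Rightarrow> real) set \<Rightarrow> (real ^ 3 \<Rightarrow> real ^ 3) set" where
  "vector_fields V = {z. \<forall>i. (\<lambda>\<xi>. z \<xi> $ i) \<in> V}"

section \<open>Matrix operations\<close>

definition frobenius :: "real ^ 3 ^ 3 \<Rightarrow> real ^ 3 ^ 3 \<Rightarrow> real" where
  "frobenius A B = trace (transpose A ** B)"

definition cof :: "real ^ 3 ^ 3 \<Rightarrow> real ^ 3 ^ 3" where
  "cof A = vector
    [vector [  A$2$2 * A$3$3 - A$2$3 * A$3$2,
             -(A$2$1 * A$3$3 - A$2$3 * A$3$1),
               A$2$1 * A$3$2 - A$2$2 * A$3$1],
     vector [-(A$1$2 * A$3$3 - A$1$3 * A$3$2),
               A$1$1 * A$3$3 - A$1$3 * A$3$1,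
             -(A$1$1 * A$3$2 - A$1$2 * A$3$1)],
     vector [  A$1$2 * A$2$3 - A$1$3 * A$2$2,
             -(A$1$1 * A$2$3 - A$1$3 * A$2$1),
               A$1$1 * A$2$2 - A$1$2 * A$2$1]]"

definition matrix_cross :: "real ^ 3 ^ 3 \<Rightarrow> real ^ 3 ^ 3 \<Rightarrow> real ^ 3 ^ 3" where
  "matrix_cross A B = cof (A + B) - cof A - cof B"

section \<open>Gauss--Legendre quadrature\<close>

text \<open>Legendre polynomials by Rodrigues' formula.\<close>

definition legendre :: "nat \<Rightarrow> real poly" where
  "legendre n = smult (1 / (2 ^ n * fact n)) ((pderiv ^^ n) ([:-1, 0, 1:] ^ n))"

text \<open>
  The \<open>n\<close> nodes are the roots of the Legendre polynomial of degree \<open>n\<close>; the weights are the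
  interpolatory ones, that is, the integrals of the Lagrange basis polynomials.
\<close>

definition gl_nodes :: "nat \<Rightarrow> real set" where
  "gl_nodes n = {t. poly (legendre n) t = 0}"

definition gl_weight :: "nat \<Rightarrow> real \<Rightarrow> real" where
  "gl_weight n s = integral {-1..1} (\<lambda>t. \<Prod>r\<in>gl_nodes n - {s}. (t - r) / (s - r))"

definition gauss_legendre :: "nat \<Rightarrow> (real ^ 3 \<Rightarrow> real) \<Rightarrow> real" where
  "gauss_legendre n f =
    (\<Sum>a\<in>gl_nodes n. \<Sum>b\<in>gl_nodes n. \<Sum>c\<in>gl_nodes n.
      gl_weight n a * gl_weight n b * gl_weight n c * f (vector [a, b, c]))"

section \<open>The quadrature defect of the trilinear form\<close>

definition triple_form ::
  "(real ^ 3 \<Rightarrow> real ^ 3) \<Rightarrow> (real ^ 3 \<Rightarrow> real ^ 3) \<Rightarrow> (real ^ 3 \<Rightarrow> real ^ 3) \<Rightarrow> real ^ 3 \<Rightarrow> real"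
  where
  "triple_form z u v = (\<lambda>\<xi>. frobenius (jacobian z (at \<xi>))
     (matrix_cross (jacobian u (at \<xi>)) (jacobian v (at \<xi>))))"

text \<open>Here the constant vectors \<open>-1\<close> and \<open>1\<close> bound the cube \<open>[-1,1]\<^sup>3\<close>.\<close>

definition quad_defect ::
  "(real ^ 3 \<Rightarrow> real ^ 3) \<Rightarrow> (real ^ 3 \<Rightarrow> real ^ 3) \<Rightarrow> (real ^ 3 \<Rightarrow> real ^ 3) \<Rightarrow> real"
  where
  "quad_defect z u v =
     gauss_legendre 4 (triple_form z u v) - integral (cbox (-1) 1) (triple_form z u v)"

end

theory Submission
  imports Defs
begin

text \<open>
  The integrand expands into determinants \<open>det (\<nabla>f, \<nabla>g, \<nabla>h)\<close> of gradients of single components, so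
  everything reduces to the defect of this scalar trilinear form. On monomials with exponents
  \<open>\<alpha>, \<beta>, \<gamma>\<close> the form is \<open>det (\<alpha>, \<beta>, \<gamma>)\<close> times the monomial with exponents \<open>\<alpha> + \<beta> + \<gamma> - 1\<close>. The
  one-dimensional four-point rule is exact up to degree 7 and wrong in degree 8, so the defect is
  nonzero only if some exponent is 8, that is \<open>\<alpha>\<^sub>i = \<beta>\<^sub>i = \<gamma>\<^sub>i = 3\<close> for some \<open>i\<close> (say \<open>i = 1\<close>), all exponents are even, and
  \<open>(\<alpha>, \<beta>, \<gamma>)\<close> is nonsingular. In \<open>\<S>\<^sub>3\<close> the exponents besides \<open>x\<^sup>3\<close> then are three distinct elements of
  \<open>{0, 1}\<^sup>2\<close> with odd sums, which forces the set \<open>{(0,0), (1,0), (0,1)}\<close>: the monomial \<open>x\<^sup>3yz\<close> is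
  invisible. Against \<open>\<Q>\<^sub>3\<close> it is detected by the pair \<open>x\<^sup>3\<close>, \<open>x\<^sup>3y\<^sup>2\<close>.
\<close>

section \<open>Moments of the four-point rule\<close>

lemma legendre_4: "legendre 4 = [:3/8, 0, -30/8, 0, 35/8:]"
proof -
  have "[:-1, 0, 1::real:] ^ 4 = [:1, 0, -4, 0, 6, 0, -4, 0, 1:]"
    by (simp add: eval_nat_numeral)
  then show ?thesis
    by (simp add: legendre_def eval_nat_numeral pderiv_pCons)
qed

lemma finite_gl_nodes_4: "finite (gl_nodes 4)"
  unfolding gl_nodes_def legendre_4 by (rule poly_roots_finite) simp

lemma gl_nodes_4_root: "s \<in> gl_nodes 4 \<Longrightarrow> 35 * s ^ 4 = 30 * s\<^sup>2 - 3"
  unfolding gl_nodes_def legendre_4 by (simp add: eval_nat_numeral algebra_simps)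

text \<open>The Legendre polynomial is quadratic in \<open>t\<^sup>2\<close>, and
  \<open>p\<^sup>2\<close>, \<open>q\<^sup>2\<close> are the two roots of that quadratic. The number
  of nodes decides up to which degree interpolation reproduces a polynomial.\<close>

lemma card_gl_nodes_4: "card (gl_nodes 4) = 4"
proof -
  define p where "p = sqrt ((15 + 2 * sqrt 30) / 35)"
  define q where "q = sqrt ((15 - 2 * sqrt 30) / 35)"
  \<comment> \<open>This makes \<open>15 - 2 * sqrt 30\<close> positive, so that \<open>q\<close> is
    a genuine positive root.\<close>
  have s30: "sqrt 30 < 7" "sqrt 30 > 0" by (auto intro: real_less_lsqrt)
  then have p2: "p\<^sup>2 = (15 + 2 * sqrt 30) / 35" and q2: "q\<^sup>2 = (15 - 2 * sqrt 30) / 35"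
    by (auto simp: p_def q_def)
  have "0 < q" "q < p" using s30 by (auto simp: p_def q_def)
  then have card: "card {p, -p, q, -q} = 4" by (simp add: card_insert_if)
  have factored: "poly (legendre 4) t = 35 / 8 * ((t\<^sup>2 - p\<^sup>2) * (t\<^sup>2 - q\<^sup>2))" for t
  proof -
    have "(t\<^sup>2 - p\<^sup>2) * (t\<^sup>2 - q\<^sup>2) = ((35 * t\<^sup>2 - 15)\<^sup>2 - 4 * (sqrt 30)\<^sup>2) / 1225"
      unfolding p2 q2 by (simp add: field_simps power2_eq_square)
    also have "(sqrt 30)\<^sup>2 = 30" by simp
    finally show ?thesis unfolding legendre_4 by (simp add: field_simps power2_eq_square)
  qed
  have "gl_nodes 4 = {p, -p, q, -q}"
    unfolding gl_nodes_def factored by (auto simp: power2_eq_iff)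
  with card show ?thesis by simp
qed

text \<open>Both sides are polynomials in \<open>t\<close> of degree below \<open>card A\<close>
  that agree on \<open>A\<close>.\<close>

lemma lagrange_interpolation:
  fixes P :: "real poly"
  assumes "finite A" "degree P < card A"
  shows "(\<Sum>s\<in>A. poly P s * (\<Prod>r\<in>A - {s}. (t - r) / (s - r))) = poly P t"
proof -
  define L where "L s = (\<Prod>r\<in>A - {s}. [:- r / (s - r), 1 / (s - r):])" for s
  have poly_L: "poly (L s) t = (\<Prod>r\<in>A - {s}. (t - r) / (s - r))" for s t
    unfolding L_def poly_prod by (rule prod.cong) (auto simp: diff_divide_distrib)
  have L_diag: "poly (L s) s = 1" for s
    unfolding poly_L by (rule prod.neutral) auto
  have L_off: "poly (L s) x = 0" if "x \<in> A" "x \<noteq> s" for s x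
    unfolding poly_L using that \<open>finite A\<close> by (intro prod_zero) auto
  have deg_L: "degree (L s) < card A" if "s \<in> A" for s
  proof -
    have "degree (L s) \<le> (\<Sum>r\<in>A - {s}. degree [:- r / (s - r), 1 / (s - r):])"
      unfolding L_def using \<open>finite A\<close> degree_prod_sum_le[of "A - {s}" "\<lambda>r. [:- r / (s - r), 1 / (s - r):]"]
      by (simp add: o_def)
    also have "\<dots> \<le> (\<Sum>r\<in>A - {s}. 1)" by (rule sum_mono) simp
    also have "\<dots> = card A - 1" using that \<open>finite A\<close> by simp
    also have "\<dots> < card A" using assms(2) by simp
    finally show ?thesis .
  qed
  let ?Q = "\<Sum>s\<in>A. smult (poly P s) (L s)"
  have "poly ?Q x = poly P x" if "x \<in> A" for x
  proof -
    have "poly ?Q x = (\<Sum>s\<in>A. if s = x then poly P x else 0)"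
      unfolding poly_sum using that by (intro sum.cong) (auto simp: L_diag L_off)
    then show ?thesis using that \<open>finite A\<close> by simp
  qed
  moreover have "degree ?Q < card A"
    using assms deg_L by (intro degree_sum_less) (auto intro: order.strict_trans1[OF degree_smult_le])
  ultimately have "?Q = P" using assms(2) by (intro poly_eqI_degree)
  then have "poly P t = poly ?Q t" by simp
  then show ?thesis by (simp add: poly_sum poly_L)
qed

definition gl_moment :: "nat \<Rightarrow> real" where
  "gl_moment n = (\<Sum>s\<in>gl_nodes 4. gl_weight 4 s * s ^ n)"

definition moment :: "nat \<Rightarrow> real" where
  "moment n = integral {-1..1} (\<lambda>t. t ^ n)"

lemma moment_eq: "moment n = (if even n then 2 / (n + 1) else 0)"
proof -
  have "((\<lambda>t. t ^ n) has_integral (1 ^ Suc n / Suc n - (-1) ^ Suc n / Suc n :: real)) {-1..1}"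
  proof (rule fundamental_theorem_of_calculus)
    fix x :: real
    have "((\<lambda>t. t ^ Suc n / Suc n) has_real_derivative x ^ n) (at x within {-1..1})"
      by (rule derivative_eq_intros refl | simp)+
    then show "((\<lambda>t. t ^ Suc n / Suc n) has_vector_derivative x ^ n) (at x within {-1..1})"
      by (rule has_real_derivative_iff_has_vector_derivative[THEN iffD1])
  qed simp
  from integral_unique[OF this] show ?thesis
    by (auto simp: moment_def add_divide_distrib[symmetric] add.commute)
qed

text \<open>The weights are integrals of the Lagrange basis, so the rule integrates the interpolant,
  which for \<open>n < 4\<close> is the power itself.\<close>

lemma gl_moment_low: "gl_moment n = moment n" if "n < 4"
proof -
  have "gl_moment n = integral {-1..1} (\<lambda>t. \<Sum>s\<in>gl_nodes 4. s ^ n * (\<Prod>r\<in>gl_nodes 4 - {s}. (t - r) / (s - r)))"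
    unfolding gl_moment_def gl_weight_def
    by (subst integral_sum[OF finite_gl_nodes_4])
       (auto intro!: integrable_continuous_real continuous_intros sum.cong simp: mult.commute)
  also have "\<dots> = moment n"
    using lagrange_interpolation[of "gl_nodes 4" "monom 1 n"] that
    by (simp add: moment_def finite_gl_nodes_4 card_gl_nodes_4 degree_monom_eq poly_monom)
  finally show ?thesis .
qed

text \<open>Every node satisfies the Legendre equation; multiplying it by \<open>s ^ n\<close> and
  summing with the weights gives a recursion. With it all moments follow from the first four,
  without explicit nodes or weights.\<close>

lemma gl_moment_rec: "35 * gl_moment (n + 4) = 30 * gl_moment (n + 2) - 3 * gl_moment n"
proof -
  have "35 * s ^ (n + 4) = 30 * s ^ (n + 2) - 3 * s ^ n" if "s \<in> gl_nodes 4" for s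
    using arg_cong[OF gl_nodes_4_root[OF that], of "\<lambda>x. s ^ n * x"]
    unfolding power_add right_diff_distrib by linarith
  then have "35 * (gl_weight 4 s * s ^ (n + 4)) = 30 * (gl_weight 4 s * s ^ (n + 2)) - 3 * (gl_weight 4 s * s ^ n)"
    if "s \<in> gl_nodes 4" for s
    using that by (metis mult.left_commute right_diff_distrib)
  then show ?thesis
    unfolding gl_moment_def sum_distrib_left sum_subtractf[symmetric] by (intro sum.cong) auto
qed

text \<open>Five steps of the recursion yield the values directly. In degree 8 the exact moment
  would be \<open>2 / 9\<close>.\<close>

lemma gl_moment_exact: "n \<le> 7 \<Longrightarrow> gl_moment n = moment n"
  and gl_moment_8: "gl_moment 8 = 258 / 1225"
proof -
  have low: "gl_moment 0 = 2" "gl_moment 1 = 0" "gl_moment 2 = 2 / 3" "gl_moment 3 = 0"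
    by (simp_all add: gl_moment_low moment_eq)
  have rec: "35 * gl_moment 4 = 30 * gl_moment 2 - 3 * gl_moment 0"
      "35 * gl_moment 5 = 30 * gl_moment 3 - 3 * gl_moment 1"
      "35 * gl_moment 6 = 30 * gl_moment 4 - 3 * gl_moment 2"
      "35 * gl_moment 7 = 30 * gl_moment 5 - 3 * gl_moment 3"
      "35 * gl_moment 8 = 30 * gl_moment 6 - 3 * gl_moment 4"
    using gl_moment_rec[of 0] gl_moment_rec[of 1] gl_moment_rec[of 2] gl_moment_rec[of 3] gl_moment_rec[of 4]
    by (simp_all add: numeral_2_eq_2 numeral_3_eq_3 eval_nat_numeral)
  have vals: "gl_moment 4 = 2 / 5" "gl_moment 5 = 0" "gl_moment 6 = 2 / 7" "gl_moment 7 = 0"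
      "gl_moment 8 = 258 / 1225"
    using rec unfolding low by linarith+
  show "gl_moment 8 = 258 / 1225" by (rule vals)
  assume "n \<le> 7"
  then consider "n < 4" | "n = 4" | "n = 5" | "n = 6" | "n = 7" by linarith
  then show "gl_moment n = moment n"
    by cases (simp_all add: gl_moment_low vals, simp_all add: moment_eq)
qed

section \<open>Monomials on the cube\<close>

text \<open>Fubini for a product of functions of one coordinate each. It is taken from Lebesgue
  integration, where \<open>lborel\<close> is the image of a product measure indexed by
  \<open>Basis\<close>.\<close>

lemma integral_cbox_prod:
  fixes g :: "'n::finite \<Rightarrow> real \<Rightarrow> real" and a b :: "real ^ 'n"
  assumes "\<And>i. continuous_on {a $ i..b $ i} (g i)"
  shows "integral (cbox a b) (\<lambda>x. \<Prod>i\<in>UNIV. g i (x $ i)) = (\<Prod>i\<in>UNIV. integral {a $ i..b $ i} (g i))"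
proof -
  \<comment> \<open>The indicator of a box is a product of indicators of intervals, so the
    restriction to the box can be absorbed into the factors.\<close>
  define h where "h i t = indicator {a $ i..b $ i} t * g i t" for i t
  have h_int: "integrable lborel (h i)" for i
    unfolding h_def using borel_integrable_compact[OF compact_Icc assms] by simp
  then have h_meas [measurable]: "h i \<in> borel_measurable borel" for i
    by (metis borel_measurable_integrable measurable_lborel2)
  have h_integral: "integral\<^sup>L lborel (h i) = integral {a $ i..b $ i} (g i)" for i
  proof -
    have "set_integrable lborel {a $ i..b $ i} (g i)"
      unfolding set_integrable_def using h_int[of i] by (simp add: h_def[abs_def])
    from set_borel_integral_eq_integral(2)[OF this] show ?thesis
      by (simp add: set_lebesgue_integral_def h_def[abs_def])
  qed
  interpret product_sigma_finite "\<lambda>_ :: real ^ 'n. lborel :: real measure" ..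
  define e :: "'n \<Rightarrow> real ^ 'n" where "e i = axis i 1" for i
  have inj_e: "inj e" by (auto simp: e_def inj_on_def axis_eq_axis)
  have Basis_e: "Basis = e ` UNIV" by (auto simp: Basis_vec_def e_def)
  \<comment> \<open>The factors are reindexed from coordinates to basis vectors, to match the index
    set of the product measure.\<close>
  define k where "k v = h (inv e v)" for v
  have k_e: "k (e i) = h i" for i by (simp add: k_def inj_e)
  have k_int: "integrable lborel (k v)" for v unfolding k_def by (rule h_int)
  have coord: "(\<Sum>v\<in>Basis. f v *\<^sub>R v) $ i = f (e i)" for f :: "real ^ 'n \<Rightarrow> real" and i
    unfolding Basis_e by (simp add: sum.reindex inj_e) (simp add: e_def axis_def if_distrib sum.delta cong: if_cong)
  let ?H = "\<lambda>x. \<Prod>i\<in>UNIV. h i (x $ i)"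
  have H_comp: "?H (\<Sum>v\<in>Basis. f v *\<^sub>R v) = (\<Prod>v\<in>Basis. k v (f v))" for f
    unfolding coord by (simp add: Basis_e prod.reindex inj_e k_e)
  have H_meas [measurable]: "?H \<in> borel_measurable borel" by measurable
  have meas: "(\<lambda>f. \<Sum>v\<in>Basis. f v *\<^sub>R v) \<in> measurable (\<Pi>\<^sub>M v\<in>Basis. lborel) (borel :: (real ^ 'n) measure)"
    by simp
  have H_int: "integrable lborel ?H"
  proof -
    have "integrable (\<Pi>\<^sub>M v\<in>Basis. lborel) (\<lambda>f. \<Prod>v\<in>Basis. k v (f v))"
      by (intro product_integrable_prod k_int) simp
    then show ?thesis
      by (subst lborel_eq, subst integrable_distr_eq[OF meas]) (simp_all only: H_comp H_meas)
  qed
  have "integral\<^sup>L lborel ?H = (\<integral>f. (\<Prod>v\<in>Basis. k v (f v)) \<partial>(\<Pi>\<^sub>M v\<in>Basis. lborel))"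
    by (subst lborel_eq, subst integral_distr[OF meas]) (simp_all only: H_comp H_meas)
  also have "\<dots> = (\<Prod>v\<in>Basis. integral\<^sup>L lborel (k v))"
    by (intro product_integral_prod k_int) auto
  also have "\<dots> = (\<Prod>i\<in>UNIV. integral {a $ i..b $ i} (g i))"
    unfolding Basis_e by (simp add: prod.reindex inj_e k_e h_integral)
  finally have eq: "integral\<^sup>L lborel ?H = \<dots>" .
  have "integral (cbox a b) (\<lambda>x. \<Prod>i\<in>UNIV. g i (x $ i)) =
      integral UNIV (\<lambda>x. if x \<in> cbox a b then \<Prod>i\<in>UNIV. g i (x $ i) else 0)"
    by (simp add: integral_restrict_UNIV)
  also have "(\<lambda>x. if x \<in> cbox a b then \<Prod>i\<in>UNIV. g i (x $ i) else 0) = ?H"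
    by (auto simp: fun_eq_iff h_def mem_box_cart indicator_def intro!: prod.cong)
  also have "integral UNIV ?H = integral\<^sup>L lborel ?H"
    using has_integral_integral_lborel[OF H_int] by (rule integral_unique)
  finally show ?thesis unfolding eq .
qed

lemma integral_monomial:
  "integral (cbox (-1) 1) (monomial_fn \<alpha>) = (\<Prod>i\<in>UNIV. moment (\<alpha> $ i))"
  unfolding monomial_fn_def moment_def
  by (subst integral_cbox_prod[where g = "\<lambda>i t. t ^ (\<alpha> $ i)"]) (intro continuous_intros, simp)

lemma prod_UNIV_3: "prod f (UNIV :: 3 set) = f 1 * f 2 * f 3"
  unfolding UNIV_3 by (simp add: ac_simps)

lemma monomial_fn_3: "monomial_fn \<alpha> \<xi> = \<xi>$1 ^ \<alpha>$1 * \<xi>$2 ^ \<alpha>$2 * \<xi>$3 ^ \<alpha>$3"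
  by (simp add: monomial_fn_def prod_UNIV_3)

lemma gauss_legendre_monomial:
  "gauss_legendre 4 (monomial_fn \<alpha>) = (\<Prod>i\<in>UNIV. gl_moment (\<alpha> $ i))"
proof -
  have "(\<Prod>i\<in>UNIV. gl_moment (\<alpha> $ i)) = gl_moment (\<alpha>$1) * (gl_moment (\<alpha>$2) * gl_moment (\<alpha>$3))"
    by (simp only: prod_UNIV_3 mult.assoc)
  also have "\<dots> = gauss_legendre 4 (monomial_fn \<alpha>)"
    unfolding gauss_legendre_def monomial_fn_3 gl_moment_def
    apply (subst sum_distrib_right, rule sum.cong[OF refl])
    apply (subst sum_distrib_right, subst sum_distrib_left, rule sum.cong[OF refl])
    apply (simp add: sum_distrib_left mult_ac)
    done
  finally show ?thesis ..
qed

section \<open>Determinants of gradients\<close>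

text \<open>Based on the same derivative as \<open>jacobian\<close>, so that the rows of a Jacobian
  are gradients of components.\<close>

definition grad :: "(real ^ 3 \<Rightarrow> real) \<Rightarrow> real ^ 3 \<Rightarrow> real ^ 3" where
  "grad f \<xi> = (\<chi> j. frechet_derivative f (at \<xi>) (axis j 1))"

text \<open>A subspace containing all monomials on which \<open>grad\<close> is linear. Continuity
  of the gradient makes the determinants below integrable over the cube.\<close>

definition C1_functions :: "(real ^ 3 \<Rightarrow> real) set" where
  "C1_functions = {f. (\<forall>\<xi>. f differentiable (at \<xi>)) \<and> continuous_on UNIV (grad f)}"

lemma grad_eqI:
  assumes "(f has_derivative f') (at \<xi>)"
  shows "grad f \<xi> = (\<chi> j. f' (axis j 1))"
  unfolding grad_def using frechet_derivative_at[OF assms] by simp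

lemma C1_functions_has_derivative:
  assumes "f \<in> C1_functions"
  shows "(f has_derivative frechet_derivative f (at \<xi>)) (at \<xi>)"
  using assms by (simp add: C1_functions_def frechet_derivative_works)

lemma grad_add:
  assumes "f \<in> C1_functions" "g \<in> C1_functions"
  shows "grad (f + g) \<xi> = grad f \<xi> + grad g \<xi>"
  unfolding plus_fun_def
  by (subst grad_eqI[OF has_derivative_add[OF assms[THEN C1_functions_has_derivative]]])
     (simp add: grad_def vec_eq_iff)

lemma grad_scaleR:
  assumes "f \<in> C1_functions"
  shows "grad (c *\<^sub>R f) \<xi> = c *\<^sub>R grad f \<xi>"
  unfolding scaleR_fun_def
  by (subst grad_eqI[OF has_derivative_scaleR_right[OF C1_functions_has_derivative[OF assms]]])
     (simp add: grad_def vec_eq_iff)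

lemma grad_zero [simp]: "grad (\<lambda>_. 0) \<xi> = 0"
  by (subst grad_eqI[OF has_derivative_const]) (simp add: vec_eq_iff)

lemma subspace_C1_functions: "subspace C1_functions"
proof (rule subspaceI)
  show "0 \<in> C1_functions" by (simp add: C1_functions_def zero_fun_def)
next
  fix f g assume fg: "f \<in> C1_functions" "g \<in> C1_functions"
  then have "grad (f + g) = (\<lambda>\<xi>. grad f \<xi> + grad g \<xi>)" by (simp add: fun_eq_iff grad_add)
  with fg show "f + g \<in> C1_functions"
    by (auto simp: C1_functions_def plus_fun_def intro!: continuous_intros differentiable_add)
next
  fix c f assume f: "f \<in> C1_functions"
  then have "grad (c *\<^sub>R f) = (\<lambda>\<xi>. c *\<^sub>R grad f \<xi>)" by (simp add: fun_eq_iff grad_scaleR)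
  with f show "c *\<^sub>R f \<in> C1_functions"
    by (auto simp: C1_functions_def scaleR_fun_def intro!: continuous_intros differentiable_scaleR)
qed

lemma has_derivative_monomial:
  "(monomial_fn \<alpha> has_derivative (\<lambda>h.
     h$1 * (\<alpha>$1 * \<xi>$1 ^ (\<alpha>$1 - 1)) * \<xi>$2 ^ \<alpha>$2 * \<xi>$3 ^ \<alpha>$3 +
     \<xi>$1 ^ \<alpha>$1 * (h$2 * (\<alpha>$2 * \<xi>$2 ^ (\<alpha>$2 - 1))) * \<xi>$3 ^ \<alpha>$3 +
     \<xi>$1 ^ \<alpha>$1 * \<xi>$2 ^ \<alpha>$2 * (h$3 * (\<alpha>$3 * \<xi>$3 ^ (\<alpha>$3 - 1))))) (at \<xi>)"
proof -
  have d: "((\<lambda>\<xi>::real^3. \<xi> $ i ^ n) has_derivative (\<lambda>h. h $ i * (n * \<xi> $ i ^ (n - 1)))) (at \<xi>)" for i n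
    using has_derivative_power[OF bounded_linear_imp_has_derivative[OF bounded_linear_vec_nth[of i]]]
    by (simp add: mult_ac)
  have "monomial_fn \<alpha> = (\<lambda>\<xi>. \<xi>$1 ^ \<alpha>$1 * \<xi>$2 ^ \<alpha>$2 * \<xi>$3 ^ \<alpha>$3)"
    by (simp add: fun_eq_iff monomial_fn_3)
  then show ?thesis
    by (simp only:) (rule has_derivative_eq_rhs[OF has_derivative_mult[OF has_derivative_mult[OF d d] d]],
        simp add: fun_eq_iff algebra_simps)
qed

lemma grad_monomial:
  "grad (monomial_fn \<alpha>) \<xi> = vector
     [\<alpha>$1 * \<xi>$1 ^ (\<alpha>$1 - 1) * \<xi>$2 ^ \<alpha>$2 * \<xi>$3 ^ \<alpha>$3,
      \<xi>$1 ^ \<alpha>$1 * (\<alpha>$2 * \<xi>$2 ^ (\<alpha>$2 - 1)) * \<xi>$3 ^ \<alpha>$3,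
      \<xi>$1 ^ \<alpha>$1 * \<xi>$2 ^ \<alpha>$2 * (\<alpha>$3 * \<xi>$3 ^ (\<alpha>$3 - 1))]"
  by (subst grad_eqI[OF has_derivative_monomial]) (simp add: vec_eq_iff forall_3 axis_def)

lemma monomial_C1_functions: "monomial_fn \<alpha> \<in> C1_functions"
proof -
  have "\<forall>i. continuous_on UNIV (\<lambda>\<xi>. grad (monomial_fn \<alpha>) \<xi> $ i)"
    unfolding forall_3 grad_monomial vector_3
    by (intro conjI continuous_on_mult continuous_on_power continuous_on_component
        continuous_on_const continuous_on_id)
  then have "continuous_on UNIV (\<lambda>\<xi>. \<chi> i. grad (monomial_fn \<alpha>) \<xi> $ i)"
    by (intro continuous_on_vec_lambda) simp
  then show ?thesis
    using has_derivative_monomial by (auto simp: C1_functions_def differentiable_def)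
qed

lemma span_monomials_C1_functions: "f \<in> span (monomial_fn ` A) \<Longrightarrow> f \<in> C1_functions"
  using span_minimal[OF _ subspace_C1_functions] monomial_C1_functions by blast

definition grad_det ::
  "(real ^ 3 \<Rightarrow> real) \<Rightarrow> (real ^ 3 \<Rightarrow> real) \<Rightarrow> (real ^ 3 \<Rightarrow> real) \<Rightarrow> real ^ 3 \<Rightarrow> real"
  where
  "grad_det f g h = (\<lambda>\<xi>. det (vector [grad f \<xi>, grad g \<xi>, grad h \<xi>] :: real ^ 3 ^ 3))"

text \<open>A cyclic permutation of rows is even. Thus linearity has to be shown for the first
  argument only.\<close>

lemma grad_det_cycle: "grad_det f g h = grad_det g h f"
  by (simp add: grad_det_def det_3 fun_eq_iff algebra_simps)

lemma grad_det_zero [simp]: "grad_det (\<lambda>_. 0) g h = (\<lambda>_. 0)"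
  by (simp add: grad_det_def det_3)

lemma grad_det_add:
  assumes "f \<in> C1_functions" "f' \<in> C1_functions"
  shows "grad_det (f + f') g h = (\<lambda>\<xi>. grad_det f g h \<xi> + grad_det f' g h \<xi>)"
  by (simp add: grad_det_def det_3 grad_add[OF assms] algebra_simps)

lemma grad_det_scaleR:
  assumes "f \<in> C1_functions"
  shows "grad_det (c *\<^sub>R f) g h = (\<lambda>\<xi>. c * grad_det f g h \<xi>)"
  by (simp add: grad_det_def det_3 grad_scaleR[OF assms] algebra_simps)

lemma grad_det_continuous:
  assumes "f \<in> C1_functions" "g \<in> C1_functions" "h \<in> C1_functions"
  shows "continuous_on UNIV (grad_det f g h)"
proof -
  have "continuous_on UNIV (\<lambda>\<xi>. grad f \<xi> $ i)" if "f \<in> C1_functions" for f i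
    using that by (intro continuous_on_component) (simp add: C1_functions_def)
  note this[OF assms(1)] this[OF assms(2)] this[OF assms(3)]
  then show ?thesis
    unfolding grad_det_def det_3 vector_3
    by (intro continuous_on_add continuous_on_diff continuous_on_mult)
qed

definition exponent_det :: "nat ^ 3 \<Rightarrow> nat ^ 3 \<Rightarrow> nat ^ 3 \<Rightarrow> real" where
  "exponent_det \<alpha> \<beta> \<gamma> =
    det (vector [\<chi> i. real (\<alpha> $ i), \<chi> i. real (\<beta> $ i), \<chi> i. real (\<gamma> $ i)] :: real ^ 3 ^ 3)"

text \<open>
  The truncated subtraction is harmless: if all three exponents of a coordinate are \<open>0\<close>, the
  determinant vanishes.
\<close>

lemma grad_det_monomial:
  "grad_det (monomial_fn \<alpha>) (monomial_fn \<beta>) (monomial_fn \<gamma>) =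
     (\<lambda>\<xi>. exponent_det \<alpha> \<beta> \<gamma> * monomial_fn (\<chi> i. \<alpha> $ i + \<beta> $ i + \<gamma> $ i - 1) \<xi>)"
proof
  fix \<xi> :: "real ^ 3"
  have pow: "(real a * x ^ (a - 1)) * x ^ b * x ^ c = real a * x ^ (a + b + c - 1)" for a b c and x :: real
    by (cases a) (simp_all add: power_add)
  define p where "p \<alpha> i = real (\<alpha> $ i) * \<xi> $ i ^ (\<alpha> $ i - 1)" for \<alpha> :: "nat ^ 3" and i
  define q where "q \<alpha> i = \<xi> $ i ^ (\<alpha> $ i)" for \<alpha> :: "nat ^ 3" and i
  define r where "r i = \<xi> $ i ^ (\<alpha> $ i + \<beta> $ i + \<gamma> $ i - 1)" for i
  have pq: "p \<alpha> i * q \<beta> i * q \<gamma> i = real (\<alpha> $ i) * r i" "p \<beta> i * q \<alpha> i * q \<gamma> i = real (\<beta> $ i) * r i"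
     "p \<gamma> i * q \<alpha> i * q \<beta> i = real (\<gamma> $ i) * r i" for i
    unfolding p_def q_def r_def pow by (simp_all add: ac_simps)
  \<comment> \<open>Each of the six terms of the determinant differentiates once in every
    coordinate. Regrouping its factors by coordinate instead of by function exposes the common
    monomial \<open>r 1 * r 2 * r 3\<close>.\<close>
  have prod3: "(p a 1 * q a 2 * q a 3) * (q b 1 * p b 2 * q b 3) * (q c 1 * q c 2 * p c 3) =
      (p a 1 * q b 1 * q c 1) * (p b 2 * q a 2 * q c 2) * (p c 3 * q a 3 * q b 3)" for a b c
    by (simp add: ac_simps)
  have pq': "p \<alpha> i * q \<gamma> i * q \<beta> i = real (\<alpha> $ i) * r i" "p \<beta> i * q \<gamma> i * q \<alpha> i = real (\<beta> $ i) * r i"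
     "p \<gamma> i * q \<beta> i * q \<alpha> i = real (\<gamma> $ i) * r i" for i
    using pq[of i] by (simp_all add: ac_simps)
  have grad: "grad (monomial_fn a) \<xi> = vector [p a 1 * q a 2 * q a 3, q a 1 * p a 2 * q a 3, q a 1 * q a 2 * p a 3]"
    for a
    by (simp add: grad_monomial p_def q_def)
  let ?G = "\<lambda>a b c. (p a 1 * q a 2 * q a 3) * (q b 1 * p b 2 * q b 3) * (q c 1 * q c 2 * p c 3)"
  have "grad_det (monomial_fn \<alpha>) (monomial_fn \<beta>) (monomial_fn \<gamma>) \<xi> =
      ?G \<alpha> \<beta> \<gamma> - ?G \<alpha> \<gamma> \<beta> + ?G \<beta> \<gamma> \<alpha> - ?G \<beta> \<alpha> \<gamma> + ?G \<gamma> \<alpha> \<beta> - ?G \<gamma> \<beta> \<alpha>"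
    unfolding grad_det_def grad det_3 vector_3 by (simp add: ac_simps)
  also have "\<dots> = exponent_det \<alpha> \<beta> \<gamma> * (r 1 * r 2 * r 3)"
    unfolding prod3 pq pq' exponent_det_def det_3 by (simp add: algebra_simps)
  finally show "grad_det (monomial_fn \<alpha>) (monomial_fn \<beta>) (monomial_fn \<gamma>) \<xi> =
      exponent_det \<alpha> \<beta> \<gamma> * monomial_fn (\<chi> i. \<alpha> $ i + \<beta> $ i + \<gamma> $ i - 1) \<xi>"
    by (simp add: monomial_fn_3 r_def)
qed

section \<open>The scalar quadrature defect\<close>

definition scalar_defect ::
  "(real ^ 3 \<Rightarrow> real) \<Rightarrow> (real ^ 3 \<Rightarrow> real) \<Rightarrow> (real ^ 3 \<Rightarrow> real) \<Rightarrow> real"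
  where
  "scalar_defect f g h = gauss_legendre 4 (grad_det f g h) - integral (cbox (-1) 1) (grad_det f g h)"

lemma gauss_legendre_add: "gauss_legendre n (\<lambda>\<xi>. f \<xi> + g \<xi>) = gauss_legendre n f + gauss_legendre n g"
  by (simp add: gauss_legendre_def distrib_left sum.distrib)

lemma gauss_legendre_mult: "gauss_legendre n (\<lambda>\<xi>. c * f \<xi>) = c * gauss_legendre n f"
  by (simp add: gauss_legendre_def sum_distrib_left mult_ac)

lemma grad_det_integrable:
  assumes "f \<in> C1_functions" "g \<in> C1_functions" "h \<in> C1_functions"
  shows "grad_det f g h integrable_on cbox (-1) 1"
  using grad_det_continuous[OF assms] by (intro integrable_continuous) (rule continuous_on_subset, auto)

lemma scalar_defect_cycle: "scalar_defect f g h = scalar_defect g h f"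
  unfolding scalar_defect_def grad_det_cycle[of f g h] ..

lemma scalar_defect_zero1 [simp]: "scalar_defect (\<lambda>_. 0) g h = 0"
  using gauss_legendre_mult[of 4 0] by (simp add: scalar_defect_def)

lemma scalar_defect_zero2 [simp]: "scalar_defect f (\<lambda>_. 0) h = 0"
  by (subst scalar_defect_cycle) simp

lemma scalar_defect_zero3 [simp]: "scalar_defect f g (\<lambda>_. 0) = 0"
  by (subst scalar_defect_cycle) simp

lemma scalar_defect_add:
  assumes "f \<in> C1_functions" "f' \<in> C1_functions" "g \<in> C1_functions" "h \<in> C1_functions"
  shows "scalar_defect (f + f') g h = scalar_defect f g h + scalar_defect f' g h"
  using assms by (simp add: scalar_defect_def grad_det_add gauss_legendre_add integral_add grad_det_integrable)

lemma scalar_defect_scaleR: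
  assumes "f \<in> C1_functions"
  shows "scalar_defect (c *\<^sub>R f) g h = c * scalar_defect f g h"
  using assms by (simp add: scalar_defect_def grad_det_scaleR gauss_legendre_mult right_diff_distrib)

lemma scalar_defect_monomial:
  "scalar_defect (monomial_fn \<alpha>) (monomial_fn \<beta>) (monomial_fn \<gamma>) =
     exponent_det \<alpha> \<beta> \<gamma> * ((\<Prod>i\<in>UNIV. gl_moment (\<alpha> $ i + \<beta> $ i + \<gamma> $ i - 1))
       - (\<Prod>i\<in>UNIV. moment (\<alpha> $ i + \<beta> $ i + \<gamma> $ i - 1)))"
  by (simp add: scalar_defect_def grad_det_monomial gauss_legendre_mult gauss_legendre_monomial
      integral_monomial right_diff_distrib)

text \<open>The determinant lowers each exponent sum by one, so the bound 8 means degree at most 7,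
  where the rule is exact.\<close>

lemma scalar_defect_monomial_exact:
  assumes "\<And>i. \<alpha> $ i + \<beta> $ i + \<gamma> $ i \<le> 8"
  shows "scalar_defect (monomial_fn \<alpha>) (monomial_fn \<beta>) (monomial_fn \<gamma>) = 0"
proof -
  have "gl_moment (\<alpha> $ i + \<beta> $ i + \<gamma> $ i - 1) = moment (\<alpha> $ i + \<beta> $ i + \<gamma> $ i - 1)" for i
    using assms[of i] by (intro gl_moment_exact) linarith
  then show ?thesis by (simp add: scalar_defect_monomial)
qed

text \<open>An even sum leaves an odd exponent after lowering by one, and the factor of coordinate
  \<open>i\<close> then vanishes in both the rule and the integral.\<close>

lemma scalar_defect_monomial_even:
  assumes "\<alpha> $ i + \<beta> $ i + \<gamma> $ i \<le> 8" "even (\<alpha> $ i + \<beta> $ i + \<gamma> $ i)"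
  shows "scalar_defect (monomial_fn \<alpha>) (monomial_fn \<beta>) (monomial_fn \<gamma>) = 0"
proof (cases "\<alpha> $ i + \<beta> $ i + \<gamma> $ i = 0")
  case True
  \<comment> \<open>For the sum 0 the truncated exponent is 0 and not odd; here a zero column of the
    exponent matrix helps.\<close>
  then have "exponent_det \<alpha> \<beta> \<gamma> = 0"
    using exhaust_3[of i] by (auto simp: exponent_det_def det_3)
  then show ?thesis by (simp add: scalar_defect_monomial)
next
  case False
  let ?n = "\<alpha> $ i + \<beta> $ i + \<gamma> $ i - 1"
  have "odd ?n" "?n \<le> 7" using assms False by auto
  then have "moment ?n = 0" "gl_moment ?n = 0" by (simp_all add: gl_moment_exact moment_eq)
  then have "(\<Prod>i\<in>UNIV. gl_moment (\<alpha> $ i + \<beta> $ i + \<gamma> $ i - 1)) = 0"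
    "(\<Prod>i\<in>UNIV. moment (\<alpha> $ i + \<beta> $ i + \<gamma> $ i - 1)) = 0"
    by (intro prod_zero bexI[of _ i] finite UNIV_I; simp)+
  then show ?thesis by (simp only: scalar_defect_monomial) simp
qed

text \<open>The coordinates other than \<open>i\<close> contribute the same nonzero even moments to
  the rule and to the integral. What remains is the error in degree 8, namely
  \<open>258 / 1225 - 2 / 9\<close>.\<close>

lemma scalar_defect_monomial_nonzero:
  assumes "exponent_det \<alpha> \<beta> \<gamma> \<noteq> 0" "\<alpha> $ i + \<beta> $ i + \<gamma> $ i = 9"
    and "\<And>j. j \<noteq> i \<Longrightarrow> \<alpha> $ j + \<beta> $ j + \<gamma> $ j \<le> 7 \<and> odd (\<alpha> $ j + \<beta> $ j + \<gamma> $ j)"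
  shows "scalar_defect (monomial_fn \<alpha>) (monomial_fn \<beta>) (monomial_fn \<gamma>) \<noteq> 0"
proof -
  let ?n = "\<lambda>j. \<alpha> $ j + \<beta> $ j + \<gamma> $ j - 1"
  have i: "?n i = 8" using assms(2) by simp
  have ev: "even (?n j) \<and> ?n j \<le> 7" if "j \<noteq> i" for j
    using assms(3)[OF that] by (auto elim!: oddE)
  have split: "(\<Prod>j\<in>UNIV. m (?n j)) = m 8 * (\<Prod>j\<in>UNIV - {i}. m (?n j))" for m :: "nat \<Rightarrow> real"
    by (subst prod.remove[of _ i]) (simp_all only: i finite UNIV_I)
  have "(\<Prod>j\<in>UNIV - {i}. gl_moment (?n j)) = (\<Prod>j\<in>UNIV - {i}. moment (?n j))"
    using ev by (intro prod.cong refl gl_moment_exact) auto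
  then have "(\<Prod>j\<in>UNIV. gl_moment (?n j)) - (\<Prod>j\<in>UNIV. moment (?n j)) =
      (258 / 1225 - 2 / 9) * (\<Prod>j\<in>UNIV - {i}. moment (?n j))"
    unfolding split gl_moment_8 by (simp add: moment_eq algebra_simps)
  moreover have "(\<Prod>j\<in>UNIV - {i}. moment (?n j)) \<noteq> 0"
    using ev by (auto simp: moment_eq)
  ultimately show ?thesis using assms(1) by (simp add: scalar_defect_monomial)
qed

section \<open>Reduction from spans to monomials\<close>

lemma subspace_scalar_defect_zero:
  assumes "g \<in> C1_functions" "h \<in> C1_functions"
  shows "subspace {f \<in> C1_functions. scalar_defect f g h = 0}"
  using assms subspace_C1_functions
  by (auto simp: subspace_def scalar_defect_add scalar_defect_scaleR zero_fun_def)

lemma scalar_defect_span1: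
  assumes "f \<in> span (monomial_fn ` A)" "g \<in> C1_functions" "h \<in> C1_functions"
    and "\<And>\<alpha>. \<alpha> \<in> A \<Longrightarrow> scalar_defect (monomial_fn \<alpha>) g h = 0"
  shows "scalar_defect f g h = 0"
  using span_minimal[OF _ subspace_scalar_defect_zero[OF assms(2,3)], of "monomial_fn ` A"]
    assms(1,4) monomial_C1_functions by auto

text \<open>One argument at a time is reduced to monomials, after cyclic rotation has brought it to
  the first place.\<close>

lemma scalar_defect_span:
  assumes "f \<in> span (monomial_fn ` A)" "g \<in> span (monomial_fn ` B)" "h \<in> span (monomial_fn ` B)"
    and zero: "\<And>\<alpha> \<beta> \<gamma>. \<alpha> \<in> A \<Longrightarrow> \<beta> \<in> B \<Longrightarrow> \<gamma> \<in> B \<Longrightarrow>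
      scalar_defect (monomial_fn \<alpha>) (monomial_fn \<beta>) (monomial_fn \<gamma>) = 0"
  shows "scalar_defect f g h = 0"
proof (rule scalar_defect_span1[OF assms(1)])
  show C1: "g \<in> C1_functions" "h \<in> C1_functions" using assms span_monomials_C1_functions by blast+
  fix \<alpha> assume \<alpha>: "\<alpha> \<in> A"
  have "scalar_defect g h (monomial_fn \<alpha>) = 0"
  proof (rule scalar_defect_span1[OF assms(2) C1(2) monomial_C1_functions])
    fix \<beta> assume \<beta>: "\<beta> \<in> B"
    have "scalar_defect h (monomial_fn \<alpha>) (monomial_fn \<beta>) = 0"
      by (rule scalar_defect_span1[OF assms(3) monomial_C1_functions monomial_C1_functions])
         (metis scalar_defect_cycle zero \<alpha> \<beta>)
    then show "scalar_defect (monomial_fn \<beta>) h (monomial_fn \<alpha>) = 0"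
      by (metis scalar_defect_cycle)
  qed
  then show "scalar_defect (monomial_fn \<alpha>) g h = 0" by (metis scalar_defect_cycle)
qed

section \<open>From vector fields to scalar components\<close>

lemma frobenius_alt: "frobenius A B = (\<Sum>i\<in>UNIV. \<Sum>j\<in>UNIV. A $ i $ j * B $ i $ j)"
  unfolding frobenius_def trace_def matrix_matrix_mult_def transpose_def
  by (simp, rule sum.swap)

text \<open>Each row of a cofactor matrix is the cross product of the two other rows, and
  \<open>matrix_cross\<close> polarises this quadratic map. Pairing with a row of \<open>A\<close>
  gives triple products.\<close>

lemma frobenius_matrix_cross:
  "frobenius A (matrix_cross B C) =
     det (vector [A$1, B$2, C$3] :: real ^ 3 ^ 3) - det (vector [A$1, B$3, C$2] :: real ^ 3 ^ 3)
   + det (vector [A$2, B$3, C$1] :: real ^ 3 ^ 3) - det (vector [A$2, B$1, C$3] :: real ^ 3 ^ 3)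
   + det (vector [A$3, B$1, C$2] :: real ^ 3 ^ 3) - det (vector [A$3, B$2, C$1] :: real ^ 3 ^ 3)"
  unfolding frobenius_alt sum_3 matrix_cross_def cof_def det_3 vector_3 vector_add_component vector_minus_component
  by (simp add: algebra_simps)

lemma jacobian_row:
  assumes "\<And>i. (\<lambda>\<xi>. z \<xi> $ i) \<in> C1_functions"
  shows "jacobian z (at \<xi>) $ i = grad (\<lambda>\<xi>. z \<xi> $ i) \<xi>"
proof -
  have "z differentiable (at \<xi>)"
    using assms by (subst differentiable_componentwise_within)
      (auto simp: C1_functions_def Basis_vec_def inner_axis)
  then have "(z has_derivative frechet_derivative z (at \<xi>)) (at \<xi>)"
    by (simp add: frechet_derivative_works)
  from bounded_linear.has_derivative[OF bounded_linear_vec_nth this]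
  show ?thesis
    by (subst grad_eqI) (auto simp: jacobian_def matrix_def vec_eq_iff)
qed

lemma quad_defect_scalar_defect:
  assumes "\<And>i. (\<lambda>\<xi>. z \<xi> $ i) \<in> C1_functions" "\<And>i. (\<lambda>\<xi>. u \<xi> $ i) \<in> C1_functions"
    "\<And>i. (\<lambda>\<xi>. v \<xi> $ i) \<in> C1_functions"
  defines "E \<equiv> \<lambda>i j k. scalar_defect (\<lambda>\<xi>. z \<xi> $ i) (\<lambda>\<xi>. u \<xi> $ j) (\<lambda>\<xi>. v \<xi> $ k)"
  shows "quad_defect z u v = E 1 2 3 - E 1 3 2 + E 2 3 1 - E 2 1 3 + E 3 1 2 - E 3 2 1"
proof -
  let ?D = "\<lambda>i j k. grad_det (\<lambda>\<xi>. z \<xi> $ i) (\<lambda>\<xi>. u \<xi> $ j) (\<lambda>\<xi>. v \<xi> $ k)"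
  let ?t = "\<lambda>\<xi>. ?D 1 2 3 \<xi> + (- 1) * ?D 1 3 2 \<xi> + ?D 2 3 1 \<xi>
    + (- 1) * ?D 2 1 3 \<xi> + ?D 3 1 2 \<xi> + (- 1) * ?D 3 2 1 \<xi>"
  have form: "triple_form z u v = ?t"
    unfolding triple_form_def frobenius_matrix_cross jacobian_row[OF assms(1)] jacobian_row[OF assms(2)]
      jacobian_row[OF assms(3)] grad_det_def by (simp add: fun_eq_iff)
  have int: "?D i j k integrable_on cbox (-1) 1" for i j k
    by (intro grad_det_integrable assms)
  have int': "(\<lambda>\<xi>. (-1) * ?D i j k \<xi>) integrable_on cbox (-1) 1" for i j k
    using integrable_cmul[OF int, of "-1"] by simp
  have "integral (cbox (-1) 1) ?t = integral (cbox (-1) 1) (?D 1 2 3) + (-1) * integral (cbox (-1) 1) (?D 1 3 2)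
    + integral (cbox (-1) 1) (?D 2 3 1) + (-1) * integral (cbox (-1) 1) (?D 2 1 3)
    + integral (cbox (-1) 1) (?D 3 1 2) + (-1) * integral (cbox (-1) 1) (?D 3 2 1)"
    by (simp only: integral_add integral_mult_right int int' integrable_add)
  then show ?thesis
    unfolding quad_defect_def form gauss_legendre_add gauss_legendre_mult E_def scalar_defect_def by linarith
qed

section \<open>Exponents and inclusions of the polynomial spaces\<close>

lemma serendipity_eq: "serendipity p = span (monomial_fn ` {\<alpha>. superlinear_degree \<alpha> \<le> p})"
  unfolding serendipity_def by (rule arg_cong[of _ _ span]) auto

lemma tensor_poly_eq: "tensor_poly p = span (monomial_fn ` {\<alpha>. \<forall>i. \<alpha> $ i \<le> p})"
  unfolding tensor_poly_def by (rule arg_cong[of _ _ span]) auto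

lemma monomial_in_serendipity: "superlinear_degree \<alpha> \<le> p \<Longrightarrow> monomial_fn \<alpha> \<in> serendipity p"
  unfolding serendipity_eq by (auto intro!: span_base)

lemma monomial_in_tensor_poly: "(\<And>i. \<alpha> $ i \<le> p) \<Longrightarrow> monomial_fn \<alpha> \<in> tensor_poly p"
  unfolding tensor_poly_eq by (auto intro!: span_base)

lemma superlinear_degree_3:
  "superlinear_degree \<alpha> =
    (if \<alpha>$1 \<ge> 2 then \<alpha>$1 else 0) + (if \<alpha>$2 \<ge> 2 then \<alpha>$2 else 0) + (if \<alpha>$3 \<ge> 2 then \<alpha>$3 else 0)"
proof -
  have "superlinear_degree \<alpha> = (\<Sum>i\<in>UNIV. if \<alpha> $ i \<ge> 2 then \<alpha> $ i else 0)"
    unfolding superlinear_degree_def using sum.inter_filter[of UNIV "\<lambda>i. \<alpha> $ i" "\<lambda>i. \<alpha> $ i \<ge> 2"] by simp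
  then show ?thesis by (simp only: sum_3)
qed

lemma exponent_le:
  assumes "superlinear_degree \<alpha> \<le> p" "1 \<le> p"
  shows "\<alpha> $ i \<le> p"
  using assms exhaust_3[of i] unfolding superlinear_degree_3 by (auto split: if_splits)

lemma serendipity_subset_tensor_poly: "1 \<le> p \<Longrightarrow> serendipity p \<subseteq> tensor_poly p"
  unfolding serendipity_eq tensor_poly_eq by (intro span_mono image_mono) (auto intro: exponent_le)

lemma serendipity_mono: "p \<le> q \<Longrightarrow> serendipity p \<subseteq> serendipity q"
  unfolding serendipity_eq by (intro span_mono image_mono) auto

lemma tensor_poly_C1_functions: "f \<in> tensor_poly p \<Longrightarrow> f \<in> C1_functions"
  unfolding tensor_poly_eq by (rule span_monomials_C1_functions)

lemma serendipity_C1_functions: "f \<in> serendipity p \<Longrightarrow> f \<in> C1_functions"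
  unfolding serendipity_eq by (rule span_monomials_C1_functions)

text \<open>Test fields with a single nonzero component isolate one scalar defect, so the condition
  on \<open>z\<close> decouples into conditions on its components.\<close>

lemma quad_defect_zero_iff:
  assumes V: "0 \<in> V" "V \<subseteq> C1_functions" and z: "\<And>i. (\<lambda>\<xi>. z \<xi> $ i) \<in> C1_functions"
  shows "(\<forall>u \<in> vector_fields V. \<forall>v \<in> vector_fields V. quad_defect z u v = 0) \<longleftrightarrow>
    (\<forall>i. \<forall>g \<in> V. \<forall>h \<in> V. scalar_defect (\<lambda>\<xi>. z \<xi> $ i) g h = 0)" (is "?L \<longleftrightarrow> ?R")
proof
  assume ?R
  show ?L
  proof (intro ballI)
    fix u v assume "u \<in> vector_fields V" "v \<in> vector_fields V"
    then have uv: "(\<lambda>\<xi>. u \<xi> $ i) \<in> V" "(\<lambda>\<xi>. v \<xi> $ i) \<in> V" for i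
      by (auto simp: vector_fields_def)
    then have "(\<lambda>\<xi>. u \<xi> $ i) \<in> C1_functions" "(\<lambda>\<xi>. v \<xi> $ i) \<in> C1_functions" for i
      using V(2) by auto
    with z \<open>?R\<close> uv show "quad_defect z u v = 0"
      by (subst quad_defect_scalar_defect) auto
  qed
next
  assume L: ?L
  show ?R
  proof (intro allI ballI)
    fix i g h assume gh: "g \<in> V" "h \<in> V"
    define u where "u j = (\<lambda>\<xi>. axis j (g \<xi>) :: real ^ 3)" for j
    define v where "v j = (\<lambda>\<xi>. axis j (h \<xi>) :: real ^ 3)" for j
    have zero: "(\<lambda>_. 0) \<in> V" using V(1) by (simp add: zero_fun_def)
    have comps: "(\<lambda>\<xi>. u j \<xi> $ k) = (if k = j then g else (\<lambda>_. 0))"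
      "(\<lambda>\<xi>. v j \<xi> $ k) = (if k = j then h else (\<lambda>_. 0))" for j k
      by (auto simp: u_def v_def axis_def)
    have "u j \<in> vector_fields V" "v j \<in> vector_fields V" for j
      using gh zero by (auto simp: vector_fields_def comps)
    with L have Q: "quad_defect z (u j) (v k) = 0" for j k by blast
    have C1: "(\<lambda>\<xi>. u j \<xi> $ k) \<in> C1_functions" "(\<lambda>\<xi>. v j \<xi> $ k) \<in> C1_functions" for j k
      using gh zero V(2) by (auto simp: comps)
    \<comment> \<open>If the two test fields point in the two directions other than
      \<open>i\<close>, only one of the six terms survives, and it involves component
      \<open>i\<close> of \<open>z\<close>.\<close>
    note E = quad_defect_scalar_defect[OF z C1(1) C1(2), unfolded comps Q]
    from exhaust_3[of i] show "scalar_defect (\<lambda>\<xi>. z \<xi> $ i) g h = 0"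
      using E[of 2 3] E[of 3 1] E[of 1 2] by (elim disjE) simp_all
  qed
qed

section \<open>Detecting the cubic monomials\<close>

text \<open>The exponents \<open>a\<close>, \<open>b\<close> belong to the coordinates that follow
  \<open>i\<close> cyclically.\<close>

definition cubic :: "3 \<Rightarrow> nat \<Rightarrow> nat \<Rightarrow> nat ^ 3" where
  "cubic i a b = (if i = 1 then vector [3, a, b] else if i = 2 then vector [b, 3, a] else vector [a, b, 3])"

lemma ex_3: "(\<exists>i::3. P i) \<longleftrightarrow> P 1 \<or> P 2 \<or> P 3"
  by (metis exhaust_3)

lemma cubic_simps:
  "cubic 1 a b = vector [3, a, b]" "cubic 2 a b = vector [b, 3, a]" "cubic 3 a b = vector [a, b, 3]"
  by (simp_all add: cubic_def)

lemma superlinear_degree_cubic: "a \<le> 1 \<Longrightarrow> b \<le> 1 \<Longrightarrow> superlinear_degree (cubic i a b) = 3"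
  using exhaust_3[of i] by (auto simp: superlinear_degree_3 cubic_simps)

text \<open>Two exponents of at least 2 would already give superlinear degree 4, so degree 3 comes
  from a single exponent 3.\<close>

lemma superlinear_degree_3_cases:
  assumes "superlinear_degree \<alpha> \<le> 3"
  obtains "superlinear_degree \<alpha> \<le> 2" | i a b where "a \<le> 1" "b \<le> 1" "\<alpha> = cubic i a b"
proof -
  have "\<exists>i. \<exists>a\<le>1. \<exists>b\<le>1. \<alpha> = cubic i a b" if "\<not> superlinear_degree \<alpha> \<le> 2"
  proof -
    from that assms have "\<alpha>$1 = 3 \<and> \<alpha>$2 \<le> 1 \<and> \<alpha>$3 \<le> 1 \<or>
        \<alpha>$2 = 3 \<and> \<alpha>$3 \<le> 1 \<and> \<alpha>$1 \<le> 1 \<or> \<alpha>$3 = 3 \<and> \<alpha>$1 \<le> 1 \<and> \<alpha>$2 \<le> 1"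
      unfolding superlinear_degree_3 by (auto split: if_splits)
    moreover have "\<alpha>$1 = 3 \<Longrightarrow> \<alpha> = cubic 1 (\<alpha>$2) (\<alpha>$3)" "\<alpha>$2 = 3 \<Longrightarrow> \<alpha> = cubic 2 (\<alpha>$3) (\<alpha>$1)"
      "\<alpha>$3 = 3 \<Longrightarrow> \<alpha> = cubic 3 (\<alpha>$1) (\<alpha>$2)"
      by (simp_all add: cubic_simps vec_eq_iff forall_3)
    ultimately show ?thesis by metis
  qed
  then show ?thesis using that by blast
qed

text \<open>
  The two probes are chosen such that the exponents of a monomial \<open>cubic i a' b'\<close> (with
  \<open>a', b' \<le> 1\<close>) and of the probes for \<open>(i, a, b)\<close> add up to odd numbers exactly for
  \<open>(a', b') = (a, b)\<close>. For \<open>(a, b) = (1, 1)\<close> this needs a probe outside of \<open>\<S>\<^sub>3\<close>.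
\<close>

definition probe1 :: "3 \<Rightarrow> nat \<Rightarrow> nat \<Rightarrow> nat ^ 3" where
  "probe1 i a b = (if a = 0 \<and> b = 0 then cubic i 1 0 else cubic i 0 0)"

definition probe2 :: "3 \<Rightarrow> nat \<Rightarrow> nat \<Rightarrow> nat ^ 3" where
  "probe2 i a b = (if b = 0 then cubic i 0 1 else cubic i (a + 1) 0)"

lemma le_Suc_0_iff: "n \<le> Suc 0 \<longleftrightarrow> n = 0 \<or> n = Suc 0"
  by linarith

text \<open>Adding a third exponent of at most 2 keeps every sum within 8. So does a cube in a
  coordinate other than \<open>i\<close> with exponents at most 1 elsewhere.\<close>

lemma probes_bound:
  assumes "a \<le> 1" "b \<le> 1"
  shows "probe1 i a b $ j + probe2 i a b $ j \<le> (if j = i then 6 else 2)"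
  using assms exhaust_3[of i] exhaust_3[of j]
  by (elim disjE) (auto simp: probe1_def probe2_def cubic_simps le_Suc_0_iff)

lemma scalar_defect_probe_low:
  assumes "a \<le> 1" "b \<le> 1" "superlinear_degree \<alpha> \<le> 2"
  shows "scalar_defect (monomial_fn \<alpha>) (monomial_fn (probe1 i a b)) (monomial_fn (probe2 i a b)) = 0"
proof (rule scalar_defect_monomial_exact)
  fix j
  show "\<alpha> $ j + probe1 i a b $ j + probe2 i a b $ j \<le> 8"
    using probes_bound[OF assms(1,2), of i j] exponent_le[OF assms(3), of j] by (auto split: if_splits)
qed

text \<open>For \<open>(a, b)\<close> other than \<open>(1, 1)\<close> the three exponent pairs next
  to the cube are \<open>(0, 0)\<close>, \<open>(1, 0)\<close>, \<open>(0, 1)\<close> in some order,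
  with sums 1 and 1. For \<open>(1, 1)\<close> they are \<open>(1, 1)\<close>,
  \<open>(0, 0)\<close>, \<open>(2, 0)\<close>, with sums 3 and 1. Both triples are affinely
  independent, which makes the exponent matrix nonsingular.\<close>

lemma scalar_defect_probe_nonzero:
  assumes "a \<le> 1" "b \<le> 1"
  shows "scalar_defect (monomial_fn (cubic i a b)) (monomial_fn (probe1 i a b)) (monomial_fn (probe2 i a b)) \<noteq> 0"
proof (rule scalar_defect_monomial_nonzero)
  have i: "i = 1 \<or> i = 2 \<or> i = 3" by (rule exhaust_3)
  show "exponent_det (cubic i a b) (probe1 i a b) (probe2 i a b) \<noteq> 0"
    using assms i by (elim disjE) (auto simp: exponent_det_def det_3 probe1_def probe2_def cubic_simps le_Suc_0_iff)
  show "cubic i a b $ i + probe1 i a b $ i + probe2 i a b $ i = 9"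
    using i by (elim disjE) (auto simp: probe1_def probe2_def cubic_simps)
  show "cubic i a b $ j + probe1 i a b $ j + probe2 i a b $ j \<le> 7
      \<and> odd (cubic i a b $ j + probe1 i a b $ j + probe2 i a b $ j)" if "j \<noteq> i" for j
    using assms i exhaust_3[of j] that
    by (elim disjE) (auto simp: probe1_def probe2_def cubic_simps le_Suc_0_iff)
qed

text \<open>If \<open>i\<close> and \<open>i'\<close> differ, no exponent sum reaches 9. If they
  agree, one of the two small exponents differs by one and turns an odd sum into an even
  one.\<close>

lemma scalar_defect_probe_off:
  assumes "a \<le> 1" "b \<le> 1" "a' \<le> 1" "b' \<le> 1" "(i, a, b) \<noteq> (i', a', b')"
  shows "scalar_defect (monomial_fn (cubic i' a' b')) (monomial_fn (probe1 i a b)) (monomial_fn (probe2 i a b)) = 0"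
proof (cases "i = i'")
  case False
  show ?thesis
  proof (rule scalar_defect_monomial_exact)
    fix j
    have "cubic i' a' b' $ j \<le> (if j = i' then 3 else 1)"
      using assms(3,4) exhaust_3[of i'] exhaust_3[of j] by (elim disjE) (auto simp: cubic_simps)
    with False probes_bound[OF assms(1,2), of i j]
    show "cubic i' a' b' $ j + probe1 i a b $ j + probe2 i a b $ j \<le> 8"
      by (auto split: if_splits)
  qed
next
  case True
  with assms(5) have "a \<noteq> a' \<or> b \<noteq> b'" by simp
  moreover have i: "i = 1 \<or> i = 2 \<or> i = 3" by (rule exhaust_3)
  ultimately have "\<exists>j. cubic i a' b' $ j + probe1 i a b $ j + probe2 i a b $ j \<le> 8
      \<and> even (cubic i a' b' $ j + probe1 i a b $ j + probe2 i a b $ j)"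
    using assms(1-4) unfolding ex_3
    by (elim disjE) (auto simp: probe1_def probe2_def cubic_simps le_Suc_0_iff)
  then show ?thesis
    unfolding True[symmetric] by (elim exE conjE) (rule scalar_defect_monomial_even)
qed

text \<open>Dual to the twelve monomials \<open>cubic i a b\<close> with \<open>a, b \<le> 1\<close>, and vanishing on \<open>\<S>\<^sub>2\<close>.\<close>

definition cubic_coeff :: "3 \<Rightarrow> nat \<Rightarrow> nat \<Rightarrow> (real ^ 3 \<Rightarrow> real) \<Rightarrow> real" where
  "cubic_coeff i a b f = scalar_defect f (monomial_fn (probe1 i a b)) (monomial_fn (probe2 i a b)) /
     scalar_defect (monomial_fn (cubic i a b)) (monomial_fn (probe1 i a b)) (monomial_fn (probe2 i a b))"

lemma cubic_coeff_add:
  "f \<in> C1_functions \<Longrightarrow> g \<in> C1_functions \<Longrightarrow> cubic_coeff i a b (f + g) = cubic_coeff i a b f + cubic_coeff i a b g"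
  by (simp add: cubic_coeff_def scalar_defect_add monomial_C1_functions add_divide_distrib)

lemma cubic_coeff_scaleR:
  "f \<in> C1_functions \<Longrightarrow> cubic_coeff i a b (c *\<^sub>R f) = c * cubic_coeff i a b f"
  by (simp add: cubic_coeff_def scalar_defect_scaleR)

lemma cubic_coeff_zero: "cubic_coeff i a b 0 = 0"
  by (simp add: cubic_coeff_def zero_fun_def)

lemma cubic_coeff_serendipity_2:
  assumes "f \<in> serendipity 2" "a \<le> 1" "b \<le> 1"
  shows "cubic_coeff i a b f = 0"
proof -
  have "scalar_defect f (monomial_fn (probe1 i a b)) (monomial_fn (probe2 i a b)) = 0"
    by (rule scalar_defect_span1[OF assms(1)[unfolded serendipity_eq]])
       (use assms in \<open>auto intro: monomial_C1_functions scalar_defect_probe_low\<close>)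
  then show ?thesis by (simp add: cubic_coeff_def)
qed

lemma cubic_coeff_cubic:
  assumes "a \<le> 1" "b \<le> 1" "a' \<le> 1" "b' \<le> 1"
  shows "cubic_coeff i a b (monomial_fn (cubic i' a' b')) = (if (i, a, b) = (i', a', b') then 1 else 0)"
  using scalar_defect_probe_off[OF assms] scalar_defect_probe_nonzero[OF assms(1,2), of i]
  by (auto simp: cubic_coeff_def)

text \<open>On \<open>serendipity 3\<close> this is the projection onto the span of the twelve cubic
  monomials along \<open>serendipity 2\<close>; its coefficients are read off from the defect
  itself.\<close>

definition cubic_part :: "(real ^ 3 \<Rightarrow> real) \<Rightarrow> real ^ 3 \<Rightarrow> real" where
  "cubic_part f = (\<Sum>(i, a, b) \<in> UNIV \<times> {0, 1} \<times> {0, 1}. cubic_coeff i a b f *\<^sub>R monomial_fn (cubic i a b))"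

lemma cubic_part_add:
  "f \<in> C1_functions \<Longrightarrow> g \<in> C1_functions \<Longrightarrow> cubic_part (f + g) = cubic_part f + cubic_part g"
  by (simp add: cubic_part_def cubic_coeff_add scaleR_add_left sum.distrib case_prod_beta)

lemma cubic_part_scaleR: "f \<in> C1_functions \<Longrightarrow> cubic_part (c *\<^sub>R f) = c *\<^sub>R cubic_part f"
  by (simp add: cubic_part_def cubic_coeff_scaleR scaleR_sum_right case_prod_beta)

lemma cubic_part_zero: "cubic_part 0 = 0"
  by (simp add: cubic_part_def cubic_coeff_zero)

lemma cubic_part_serendipity_2: "f \<in> serendipity 2 \<Longrightarrow> cubic_part f = 0"
  unfolding cubic_part_def by (rule sum.neutral) (auto simp: cubic_coeff_serendipity_2)

lemma cubic_part_cubic: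
  assumes "a \<le> 1" "b \<le> 1"
  shows "cubic_part (monomial_fn (cubic i a b)) = monomial_fn (cubic i a b)"
proof -
  have "cubic_part (monomial_fn (cubic i a b)) =
      (\<Sum>t \<in> UNIV \<times> {0, 1} \<times> {0, 1}. if t = (i, a, b) then monomial_fn (cubic i a b) else 0)"
    unfolding cubic_part_def by (rule sum.cong) (use assms in \<open>auto simp: cubic_coeff_cubic\<close>)
  also have "\<dots> = monomial_fn (cubic i a b)"
    using assms by (subst sum.delta) (auto simp: le_Suc_0_iff)
  finally show ?thesis .
qed

lemma diff_cubic_part:
  assumes "f \<in> serendipity 3"
  shows "f - cubic_part f \<in> serendipity 2"
proof -
  \<comment> \<open>Membership in \<open>C1_functions\<close> is carried along because the linearity
    of \<open>cubic_part\<close> is available there.\<close>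
  let ?W = "{f \<in> C1_functions. f - cubic_part f \<in> serendipity 2}"
  have "subspace ?W"
  proof (rule subspaceI)
    show "0 \<in> ?W"
      using subspace_0[OF subspace_C1_functions] by (simp add: cubic_part_zero serendipity_def span_zero)
  next
    fix f g assume "f \<in> ?W" "g \<in> ?W"
    then show "f + g \<in> ?W"
      using span_add[of "f - cubic_part f" _ "g - cubic_part g"] subspace_add[OF subspace_C1_functions]
      by (auto simp: cubic_part_add serendipity_def algebra_simps)
  next
    fix c f assume "f \<in> ?W"
    then show "c *\<^sub>R f \<in> ?W"
      using span_scale[of "f - cubic_part f" _ c] subspace_scale[OF subspace_C1_functions]
      by (auto simp: cubic_part_scaleR serendipity_def scaleR_diff_right)
  qed
  moreover have "monomial_fn ` {\<alpha>. superlinear_degree \<alpha> \<le> 3} \<subseteq> ?W"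
  proof safe
    fix \<alpha> assume "superlinear_degree \<alpha> \<le> 3"
    then show "monomial_fn \<alpha> - cubic_part (monomial_fn \<alpha>) \<in> serendipity 2"
    proof (cases rule: superlinear_degree_3_cases)
      case 1
      then show ?thesis by (simp add: cubic_part_serendipity_2 monomial_in_serendipity)
    next
      case (2 i a b)
      then show ?thesis by (simp add: cubic_part_cubic serendipity_def span_zero)
    qed
  qed (rule monomial_C1_functions)
  ultimately have "serendipity 3 \<subseteq> ?W"
    unfolding serendipity_eq[of 3] by (intro span_minimal)
  with assms show ?thesis by auto
qed

section \<open>The kernels for the two spaces of variations\<close>

lemma scalar_defect_serendipity_2:
  assumes "f \<in> serendipity 2" "g \<in> tensor_poly 3" "h \<in> tensor_poly 3"
  shows "scalar_defect f g h = 0"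
proof (rule scalar_defect_span[OF assms[unfolded serendipity_eq tensor_poly_eq]])
  fix \<alpha> \<beta> \<gamma> :: "nat ^ 3"
  assume "\<alpha> \<in> {\<alpha>. superlinear_degree \<alpha> \<le> 2}" and le: "\<beta> \<in> {\<alpha>. \<forall>i. \<alpha> $ i \<le> 3}" "\<gamma> \<in> {\<alpha>. \<forall>i. \<alpha> $ i \<le> 3}"
  then have "\<alpha> $ i \<le> 2" for i by (auto intro: exponent_le)
  \<comment> \<open>The total 8 is the largest exponent sum for which the rule is still
    exact.\<close>
  with le have "\<alpha> $ i + \<beta> $ i + \<gamma> $ i \<le> 2 + 3 + 3" for i
    by (intro add_mono) auto
  then show "scalar_defect (monomial_fn \<alpha>) (monomial_fn \<beta>) (monomial_fn \<gamma>) = 0"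
    by (intro scalar_defect_monomial_exact) simp
qed

definition bubble_space :: "(real ^ 3 \<Rightarrow> real) set" where
  "bubble_space = span (monomial_fn ` range (\<lambda>i. cubic i 1 1))"

lemma bubble_space_subset: "bubble_space \<subseteq> serendipity 3"
  unfolding bubble_space_def serendipity_eq
  by (intro span_mono image_mono) (auto simp: superlinear_degree_cubic)

text \<open>Only \<beta> and \<gamma> that both have exponent 3 in coordinate \<open>i\<close> could
  be harmful. Their other exponents form pairs in \<open>{0, 1}\<close>: equal pairs make the
  determinant vanish, different pairs produce an even sum.\<close>

lemma scalar_defect_bubble:
  assumes "f \<in> bubble_space" "g \<in> serendipity 3" "h \<in> serendipity 3"
  shows "scalar_defect f g h = 0"
proof (rule scalar_defect_span[OF assms[unfolded bubble_space_def serendipity_eq]])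
  fix \<alpha> \<beta> \<gamma> :: "nat ^ 3"
  assume "\<alpha> \<in> range (\<lambda>i. cubic i 1 1)" and "\<beta> \<in> {\<alpha>. superlinear_degree \<alpha> \<le> 3}" "\<gamma> \<in> {\<alpha>. superlinear_degree \<alpha> \<le> 3}"
  then obtain i where \<alpha>: "\<alpha> = cubic i 1 1" and le: "superlinear_degree \<beta> \<le> 3" "superlinear_degree \<gamma> \<le> 3"
    by auto
  have i: "i = 1 \<or> i = 2 \<or> i = 3" by (rule exhaust_3)
  have \<alpha>_le: "\<alpha> $ j \<le> (if j = i then 3 else 1)" for j
    using i exhaust_3[of j] unfolding \<alpha> by (elim disjE) (auto simp: cubic_simps)
  have \<beta>\<gamma>_le: "\<beta> $ j \<le> 3" "\<gamma> $ j \<le> 3" for j using le by (auto intro: exponent_le)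
  show "scalar_defect (monomial_fn \<alpha>) (monomial_fn \<beta>) (monomial_fn \<gamma>) = 0"
  proof (cases "\<beta> $ i = 3 \<and> \<gamma> $ i = 3")
    case False
    show ?thesis
    proof (rule scalar_defect_monomial_exact)
      fix j
      show "\<alpha> $ j + \<beta> $ j + \<gamma> $ j \<le> 8"
        using False \<alpha>_le[of j] \<beta>\<gamma>_le[of j] by (cases "j = i") auto
    qed
  next
    case True
    have face: "\<exists>a\<le>1. \<exists>b\<le>1. \<delta> = cubic i a b" if "superlinear_degree \<delta> \<le> 3" "\<delta> $ i = 3" for \<delta>
      using that(1)
    proof (cases rule: superlinear_degree_3_cases)
      case 1
      then show ?thesis using exponent_le[of \<delta> 2 i] that(2) by simp
    next
      case (2 i' a b)
      then have "i' = i"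
        using i exhaust_3[of i'] that(2) by (elim disjE) (auto simp: cubic_simps)
      with 2 show ?thesis by blast
    qed
    obtain a b c d where ab: "a \<le> 1" "b \<le> 1" "\<beta> = cubic i a b" and cd: "c \<le> 1" "d \<le> 1" "\<gamma> = cubic i c d"
      using face[OF le(1)] face[OF le(2)] True by blast
    show ?thesis
    proof (cases "a = c \<and> b = d")
      case True
      then have "exponent_det \<alpha> \<beta> \<gamma> = 0"
        unfolding ab cd by (simp add: exponent_det_def det_3)
      then show ?thesis by (simp add: scalar_defect_monomial)
    next
      case False
      \<comment> \<open>Where the pairs differ, their exponents are 0 and 1, and with the exponent 1
        of \<alpha> the sum is 2.\<close>
      then have "\<exists>j. \<alpha> $ j + \<beta> $ j + \<gamma> $ j \<le> 8 \<and> even (\<alpha> $ j + \<beta> $ j + \<gamma> $ j)"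
        using ab(1,2) cd(1,2) i unfolding \<alpha> ab(3) cd(3) ex_3
        by (elim disjE) (auto simp: cubic_simps le_Suc_0_iff)
      then show ?thesis by (elim exE conjE) (rule scalar_defect_monomial_even)
    qed
  qed
qed

lemma cubic_part_bubble:
  assumes "f \<in> bubble_space"
  shows "cubic_part f = f"
proof -
  have "subspace {f \<in> C1_functions. cubic_part f = f}"
    using subspace_C1_functions by (auto simp: subspace_def cubic_part_zero cubic_part_add cubic_part_scaleR)
  then have "bubble_space \<subseteq> {f \<in> C1_functions. cubic_part f = f}"
    unfolding bubble_space_def by (intro span_minimal) (auto simp: cubic_part_cubic monomial_C1_functions)
  with assms show ?thesis by auto
qed

text \<open>The map \<open>cubic_part\<close> is zero on the first space and the identity on the
  second.\<close>

lemma serendipity_2_bubble_disjoint: "serendipity 2 \<inter> bubble_space = {0}"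
  using cubic_part_bubble cubic_part_serendipity_2
  by (fastforce simp: bubble_space_def serendipity_def span_zero)

text \<open>The pair \<open>(1, 1)\<close> is excluded because \<open>probe2 i 1 1\<close> is
  \<open>cubic i 2 0\<close>, of superlinear degree 5.\<close>

lemma probe_in_serendipity:
  assumes "a \<le> 1" "b \<le> 1" "(a, b) \<noteq> (1, 1)"
  shows "monomial_fn (probe1 i a b) \<in> serendipity 3" "monomial_fn (probe2 i a b) \<in> serendipity 3"
  using assms by (auto simp: probe1_def probe2_def le_Suc_0_iff superlinear_degree_cubic intro!: monomial_in_serendipity)

lemma probe_in_tensor_poly:
  assumes "a \<le> 1" "b \<le> 1"
  shows "monomial_fn (probe1 i a b) \<in> tensor_poly 3" "monomial_fn (probe2 i a b) \<in> tensor_poly 3"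
proof -
  have "cubic i a' b' $ j \<le> 3" if "a' \<le> 2" "b' \<le> 2" for a' b' j
    using that exhaust_3[of i] exhaust_3[of j] by (elim disjE) (auto simp: cubic_simps)
  then show "monomial_fn (probe1 i a b) \<in> tensor_poly 3" "monomial_fn (probe2 i a b) \<in> tensor_poly 3"
    using assms by (auto simp: probe1_def probe2_def intro!: monomial_in_tensor_poly)
qed

text \<open>The probes inside \<open>serendipity 3\<close> force nine of the twelve cubic
  coefficients to vanish; the three that remain belong to \<open>bubble_space\<close>.\<close>

lemma kernel_serendipity:
  assumes "f \<in> serendipity 3"
  shows "(\<forall>g \<in> serendipity 3. \<forall>h \<in> serendipity 3. scalar_defect f g h = 0) \<longleftrightarrow> f \<in> serendipity 2 + bubble_space"
proof
  assume zero: "\<forall>g \<in> serendipity 3. \<forall>h \<in> serendipity 3. scalar_defect f g h = 0"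
  have "cubic_part f \<in> bubble_space"
    unfolding cubic_part_def
  proof (rule span_sum[of _ _ "monomial_fn ` range (\<lambda>i. cubic i 1 1)", folded bubble_space_def])
    fix t assume "t \<in> (UNIV :: 3 set) \<times> {0, 1 :: nat} \<times> {0, 1 :: nat}"
    then obtain i a b where t: "t = (i, a, b)" "a \<le> 1" "b \<le> 1" by auto
    have "cubic_coeff i a b f *\<^sub>R monomial_fn (cubic i a b) \<in> bubble_space"
    proof (cases "(a, b) = (1, 1)")
      case True
      then show ?thesis unfolding bubble_space_def by (intro span_scale span_base) auto
    next
      case False
      then have "cubic_coeff i a b f = 0"
        using probe_in_serendipity[OF t(2,3)] zero by (simp add: cubic_coeff_def)
      then show ?thesis by (simp add: bubble_space_def span_zero)
    qed
    then show "(case t of (i, a, b) \<Rightarrow> cubic_coeff i a b f *\<^sub>R monomial_fn (cubic i a b)) \<in> bubble_space"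
      by (simp add: t)
  qed
  then show "f \<in> serendipity 2 + bubble_space"
    using set_plus_intro[OF diff_cubic_part[OF assms]] by fastforce
next
  assume "f \<in> serendipity 2 + bubble_space"
  then obtain s c where f: "f = s + c" and s: "s \<in> serendipity 2" and c: "c \<in> bubble_space"
    by (auto elim: set_plus_elim)
  show "\<forall>g \<in> serendipity 3. \<forall>h \<in> serendipity 3. scalar_defect f g h = 0"
  proof (intro ballI)
    fix g h assume gh: "g \<in> serendipity 3" "h \<in> serendipity 3"
    have "scalar_defect s g h = 0"
      using gh serendipity_subset_tensor_poly[of 3] by (intro scalar_defect_serendipity_2 s) auto
    moreover have "scalar_defect c g h = 0" by (rule scalar_defect_bubble[OF c gh])
    moreover have "s \<in> C1_functions" "c \<in> C1_functions" "g \<in> C1_functions" "h \<in> C1_functions"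
      using s c gh bubble_space_subset by (auto intro: serendipity_C1_functions)
    ultimately show "scalar_defect f g h = 0" unfolding f by (simp add: scalar_defect_add)
  qed
qed

text \<open>Now the probes for \<open>(1, 1)\<close> are admissible as well, so all twelve cubic
  coefficients vanish.\<close>

lemma kernel_tensor_poly:
  assumes "f \<in> serendipity 3"
  shows "(\<forall>g \<in> tensor_poly 3. \<forall>h \<in> tensor_poly 3. scalar_defect f g h = 0) \<longleftrightarrow> f \<in> serendipity 2"
proof
  assume zero: "\<forall>g \<in> tensor_poly 3. \<forall>h \<in> tensor_poly 3. scalar_defect f g h = 0"
  have "cubic_part f = 0"
    unfolding cubic_part_def
    by (rule sum.neutral) (use zero probe_in_tensor_poly in \<open>auto simp: cubic_coeff_def\<close>)
  then show "f \<in> serendipity 2" using diff_cubic_part[OF assms] by simp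
qed (auto intro: scalar_defect_serendipity_2)

lemma vector_fields_kernel:
  assumes V: "0 \<in> V" "V \<subseteq> C1_functions" and "W \<subseteq> serendipity 3"
    and "\<And>f. f \<in> serendipity 3 \<Longrightarrow> (\<forall>g \<in> V. \<forall>h \<in> V. scalar_defect f g h = 0) \<longleftrightarrow> f \<in> W"
  shows "{z \<in> vector_fields (serendipity 3).
      \<forall>u \<in> vector_fields V. \<forall>v \<in> vector_fields V. quad_defect z u v = 0}
    = vector_fields W"
proof -
  have "(\<forall>u \<in> vector_fields V. \<forall>v \<in> vector_fields V. quad_defect z u v = 0) \<longleftrightarrow> z \<in> vector_fields W"
    if "z \<in> vector_fields (serendipity 3)" for z
  proof -
    have z: "(\<lambda>\<xi>. z \<xi> $ i) \<in> serendipity 3" for i using that by (simp add: vector_fields_def)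
    then show ?thesis
      using quad_defect_zero_iff[OF V serendipity_C1_functions[OF z]] assms(4)[OF z]
      by (simp add: vector_fields_def)
  qed
  moreover have "vector_fields W \<subseteq> vector_fields (serendipity 3)"
    using assms(3) by (auto simp: vector_fields_def)
  ultimately show ?thesis by blast
qed

text \<open>The sum of sets \<open>serendipity 2 + C\<close> is direct by the first
  conjunct.\<close>

theorem theorem5:
  defines "C \<equiv> span {\<lambda>\<xi>::real^3. (\<xi>$1)^3 * \<xi>$2 * \<xi>$3,
                      \<lambda>\<xi>. \<xi>$1 * (\<xi>$2)^3 * \<xi>$3,
                      \<lambda>\<xi>. \<xi>$1 * \<xi>$2 * (\<xi>$3)^3}"
  shows "serendipity 2 \<inter> C = {0}
    \<and> {z \<in> vector_fields (serendipity 3).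
          \<forall>u \<in> vector_fields (serendipity 3). \<forall>v \<in> vector_fields (serendipity 3).
            quad_defect z u v = 0}
        = vector_fields (serendipity 2 + C)
    \<and> {z \<in> vector_fields (serendipity 3).
          \<forall>u \<in> vector_fields (tensor_poly 3). \<forall>v \<in> vector_fields (tensor_poly 3).
            quad_defect z u v = 0}
        = vector_fields (serendipity 2)"
proof -
  have C: "C = bubble_space"
    unfolding C_def bubble_space_def UNIV_3
    by (simp add: cubic_simps monomial_fn_3[abs_def])
  have S23: "serendipity 2 \<subseteq> serendipity 3" by (rule serendipity_mono) simp
  have sum: "serendipity 2 + bubble_space \<subseteq> serendipity 3"
    using S23 bubble_space_subset by (auto simp: serendipity_def elim!: set_plus_elim intro!: span_add)
  have S: "0 \<in> serendipity 3" "serendipity 3 \<subseteq> C1_functions"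
    using serendipity_C1_functions by (auto simp: serendipity_eq span_zero)
  have Q: "0 \<in> tensor_poly 3" "tensor_poly 3 \<subseteq> C1_functions"
    using tensor_poly_C1_functions by (auto simp: tensor_poly_eq span_zero)
  show ?thesis
    unfolding C
    by (intro conjI serendipity_2_bubble_disjoint vector_fields_kernel[OF S sum kernel_serendipity]
        vector_fields_kernel[OF Q S23 kernel_tensor_poly])
qed

end
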